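(* Let $n\ge 1$ and let $f_1,f_2:\mathbb{F}_2^n\times\mathbb{F}_2^n\to\mathbb{F}_2$ be two bilinear functions. Let $\alpha_1,\alpha_2:\mathbb{F}_2^n\to\mathbb{F}_2$ be the quadratic forms defined by $\alpha_1(x)=f_1(x,x)$ and $\alpha_2(x)=f_2(x,x)$. Then the twisted group algebras $(\mathbb{R}[\mathbb{F}_2^n],f_1)$ and $(\mathbb{R}[\mathbb{F}_2^n],f_2)$ are isomorphic (as algebras over $\mathbb{R}$) if and only if the quadratic forms $\alpha_1$ and $\alpha_2$ are equivalent.
   Context: $\mathbb{F}_2$ is the field with two elements. $\mathbb{R}[\mathbb{F}_2^n]$ denotes the real vector space of dimension $2^n$ with basis $\{e_x : x\in\mathbb{F}_2^n\}$. For a function $f:\mathbb{F}_2^n\times\mathbb{F}_2^n\to\mathbb{F}_2$, the twisted group algebra $(\mathbb{R}[\mathbb{F}_2^n],f)$ is the vector space $\mathbb{R}[\mathbb{F}_2^n]$ equipped with the $\mathbb{R}$-bilinear product determined by $$e_x\cdot e_y=(-1)^{f(x,y)}e_{x+y},\qquad x,y\in\mathbb{F}_2^n .$$ A quadratic form on $\mathbb{F}_2^n$ is a function $\mathbf{q}:\mathbb{F}_2^n\to\mathbb{F}_2$ of the form $\mathbf{q}(x)=\sum_{1\le i\le j\le n}q_{ij}x_ix_j$ with $q_{ij}\in\mathbb{F}_2$ (the form may be degenerate or zero; the diagonal terms $q_{ii}x_i^2=q_{ii}x_i$ are its linear part). Two quadratic forms $\mathbf{q},\mathbf{q}'$ on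 $\mathbb{F}_2^n$ are equivalent if they differ by a linear change of coordinates, i.e. there is an invertible linear map $T:\mathbb{F}_2^n\to\mathbb{F}_2^n$ with $\mathbf{q}'(x)=\mathbf{q}(Tx)$ for all $x\in\mathbb{F}_2^n$. *)

theory Defs
  imports "HOL-Analysis.Analysis" "HOL-Library.Z2"
begin

instance bit :: finite
proof
  have "UNIV \<subseteq> {0, 1 :: bit}"
    using bit.exhaust by auto
  then show "finite (UNIV :: bit set)"
    by (rule finite_subset) simp
qed

definition bilinear_form :: "(bit ^ 'n \<Rightarrow> bit ^ 'n \<Rightarrow> bit) \<Rightarrow> bool" where
  "bilinear_form f \<longleftrightarrow>
     (\<forall>x. Vector_Spaces.linear (*s) (*) (\<lambda>y. f x y)) \<and>
     (\<forall>y. Vector_Spaces.linear (*s) (*) (\<lambda>x. f x y))"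

(* The index type plays the role of {1, ..., n}; its order is used only to sum over i \<le> j. *)
definition quadratic_form :: "((bit, 'n::{finite,linorder}) vec \<Rightarrow> bit) \<Rightarrow> bool" where
  "quadratic_form q \<longleftrightarrow>
     (\<exists>c :: 'n \<Rightarrow> 'n \<Rightarrow> bit. \<forall>x. q x = (\<Sum>(i, j) \<in> {(i, j). i \<le> j}. c i j * x $ i * x $ j))"

definition quadratic_equivalent ::
  "((bit, 'n::{finite,linorder}) vec \<Rightarrow> bit) \<Rightarrow> ((bit, 'n) vec \<Rightarrow> bit) \<Rightarrow> bool" where
  "quadratic_equivalent q q' \<longleftrightarrow>
     quadratic_form q \<and> quadratic_form q' \<and>
     (\<exists>T :: (bit, 'n) vec \<Rightarrow> (bit, 'n) vec.
        Vector_Spaces.linear (*s) (*s) T \<and> bij T \<and> (\<forall>x. q' x = q (T x)))"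

lemma bilinear_form_eq_sum:
  assumes "bilinear_form f"
  shows "f x y = (\<Sum>i\<in>UNIV. \<Sum>j\<in>UNIV. f (axis i 1) (axis j 1) * x $ i * y $ j)"
proof -
  have R: "f u (\<Sum>j\<in>UNIV. y $ j *s axis j 1) = (\<Sum>j\<in>UNIV. y $ j * f u (axis j 1))" for u
  proof -
    interpret Vector_Spaces.linear "(*s)" "(*)" "\<lambda>y. f u y"
      using assms by (simp add: bilinear_form_def)
    show ?thesis by (simp add: sum scale del: mult_bit_eq_and)
  qed
  have L: "f (\<Sum>i\<in>UNIV. x $ i *s axis i 1) v = (\<Sum>i\<in>UNIV. x $ i * f (axis i 1) v)" for v
  proof -
    interpret Vector_Spaces.linear "(*s)" "(*)" "\<lambda>x. f x v"
      using assms by (simp add: bilinear_form_def)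
    show ?thesis by (simp add: sum scale del: mult_bit_eq_and)
  qed
  have "f x y = (\<Sum>i\<in>UNIV. x $ i * f (axis i 1) y)"
    using L[of y] by (simp only: basis_expansion)
  also have "\<dots> = (\<Sum>i\<in>UNIV. x $ i * (\<Sum>j\<in>UNIV. y $ j * f (axis i 1) (axis j 1)))"
    using R by (simp only: basis_expansion)
  also have "\<dots> = (\<Sum>i\<in>UNIV. \<Sum>j\<in>UNIV. f (axis i 1) (axis j 1) * x $ i * y $ j)"
    unfolding sum_distrib_left
    by (intro sum.cong refl) (metis mult.assoc mult.commute)
  finally show ?thesis .
qed

lemma quadratic_form_diagonal:
  fixes f :: "(bit, 'n::{finite,linorder}) vec \<Rightarrow> (bit, 'n) vec \<Rightarrow> bit"
  assumes "bilinear_form f"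
  shows "quadratic_form (\<lambda>x. f x x)"
proof -
  define g where "g i j = f (axis i 1) (axis j 1)" for i j :: 'n
  define c where "c i j = (if i = j then g i i else g i j + g j i)" for i j
  have "f x x = (\<Sum>(i, j) \<in> {(i, j). i \<le> j}. c i j * x $ i * x $ j)" for x
  proof -
    define h where "h = (\<lambda>(i, j). g i j * x $ i * x $ j)"
    have "f x x = (\<Sum>p\<in>UNIV. h p)"
      by (subst bilinear_form_eq_sum[OF assms])
         (simp only: h_def g_def sum.cartesian_product UNIV_Times_UNIV)
    also have "(UNIV :: ('n \<times> 'n) set) = ({(i, j). i = j} \<union> {(i, j). i < j}) \<union> {(i, j). j < i}"
      by auto
    also have "(\<Sum>p\<in>\<dots>. h p) =
        (\<Sum>p\<in>{(i, j). i = j}. h p) + (\<Sum>p\<in>{(i, j). i < j}. h p) + (\<Sum>p\<in>{(i, j). j < i}. h p)"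
      by (subst sum.union_disjoint, simp, simp, force, subst sum.union_disjoint, auto)
    also have "(\<Sum>p\<in>{(i, j). j < i}. h p) = (\<Sum>p\<in>{(i, j). i < j}. h (prod.swap p))"
      by (rule sum.reindex_bij_witness[of _ prod.swap prod.swap]) auto
    also have "(\<Sum>p\<in>{(i, j). i = j}. h p) + (\<Sum>p\<in>{(i, j). i < j}. h p) + \<dots> =
        (\<Sum>p\<in>{(i, j). i = j}. h p) + (\<Sum>p\<in>{(i, j). i < j}. h p + h (prod.swap p))"
      by (simp only: sum.distrib add.assoc)
    also have "(\<Sum>p\<in>{(i, j). i = j}. h p) = (\<Sum>(i, j)\<in>{(i, j). i = j}. c i j * x $ i * x $ j)"
      by (rule sum.cong) (auto simp: h_def c_def)
    also have "(\<Sum>p\<in>{(i, j). i < j}. h p + h (prod.swap p)) =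
        (\<Sum>(i, j)\<in>{(i, j). i < j}. c i j * x $ i * x $ j)"
    proof (rule sum.cong)
      fix p :: "'n \<times> 'n" assume "p \<in> {(i, j). i < j}"
      then obtain i j where p: "p = (i, j)" "i \<noteq> j" by auto
      have "g i j * x $ i * x $ j + g j i * x $ j * x $ i = (g i j + g j i) * x $ i * x $ j"
        by (cases "x $ i"; cases "x $ j") simp_all
      then show "h p + h (prod.swap p) = (case p of (i, j) \<Rightarrow> c i j * x $ i * x $ j)"
        using p by (simp add: h_def c_def del: add_bit_eq_xor mult_bit_eq_and)
    qed simp
    also have "(\<Sum>(i, j)\<in>{(i, j). i = j}. c i j * x $ i * x $ j) + \<dots> =
        (\<Sum>(i, j)\<in>{(i, j). i = j} \<union> {(i, j). i < j}. c i j * x $ i * x $ j)"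
      by (rule sum.union_disjoint[symmetric]) auto
    also have "{(i, j). i = j} \<union> {(i, j). i < j} = {(i, j). i \<le> (j :: 'n)}"
      by auto
    finally show ?thesis .
  qed
  then show ?thesis
    unfolding quadratic_form_def by blast
qed

(* (-1)^b for an exponent b in the field with two elements *)
definition sign_bit :: "bit \<Rightarrow> real" where
  "sign_bit b = (if b = 0 then 1 else - 1)"

(* The vector space R[F_2^n] is real ^ (bit ^ 'n), and its basis vector e_x is axis x 1.
   The product is the bilinear extension of e_x e_y = (-1)^(f x y) e_(x + y). *)
definition twisted_mult ::
  "(bit ^ 'n \<Rightarrow> bit ^ 'n \<Rightarrow> bit) \<Rightarrow>
   real ^ (bit ^ 'n) \<Rightarrow> real ^ (bit ^ 'n) \<Rightarrow> real ^ (bit ^ 'n)" where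
  "twisted_mult f a b =
     (\<Sum>x\<in>UNIV. \<Sum>y\<in>UNIV. (a $ x * b $ y * sign_bit (f x y)) *\<^sub>R axis (x + y) 1)"

lemma bilinear_twisted_mult: "bilinear (twisted_mult f)"
  unfolding bilinear_def linear_iff twisted_mult_def
  by (simp add: algebra_simps sum.distrib scaleR_sum_right)

lemma twisted_mult_basis:
  "twisted_mult f (axis x 1) (axis y 1) = sign_bit (f x y) *\<^sub>R axis (x + y) 1"
proof -
  have "twisted_mult f (axis x 1) (axis y 1) =
    (\<Sum>u\<in>UNIV. \<Sum>v\<in>UNIV.
       if u = x then if v = y then sign_bit (f u v) *\<^sub>R axis (u + v) 1 else 0 else 0)"
    unfolding twisted_mult_def by (intro sum.cong refl) (auto simp: axis_def)
  also have "\<dots> = (\<Sum>u\<in>UNIV. if u = x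
       then (\<Sum>v\<in>UNIV. if v = y then sign_bit (f u v) *\<^sub>R axis (u + v) 1 else 0) else 0)"
    by (intro sum.cong refl) (simp del: add_bit_eq_xor)
  also have "\<dots> = sign_bit (f x y) *\<^sub>R axis (x + y) 1"
    by (simp del: add_bit_eq_xor)
  finally show ?thesis .
qed

(* Isomorphism of the real algebras (V, mA) and (W, mB). No condition on units is needed,
   since a multiplicative bijection carries a unit to a unit. *)
definition algebra_isomorphic ::
  "('a::real_vector \<Rightarrow> 'a \<Rightarrow> 'a) \<Rightarrow> ('b::real_vector \<Rightarrow> 'b \<Rightarrow> 'b) \<Rightarrow> bool" where
  "algebra_isomorphic mA mB \<longleftrightarrow>
     (\<exists>\<phi> :: 'a \<Rightarrow> 'b. linear \<phi> \<and> bij \<phi> \<and> (\<forall>a b. \<phi> (mA a b) = mB (\<phi> a) (\<phi> b)))"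

end

(* For f bilinear, the polar form of the diagonal q(x) = f(x, x) is B(x, y) = f(x, y) + f(y, x).

   If q2 = q1 o T, then f1(Tx, Ty) + f2(x, y) is alternating, hence equals g(x + y) + g(x) + g(y)
   for some g, and sending e_(Tx) to (-1)^g(x) e_x is an isomorphism.

   Conversely, two numbers can be read off the algebra. The center is spanned by the e_x with x in
   the radical of B, so its dimension is the size of the radical. Left multiplication by a has
   trace 2^n a_0, so a_0 is invariant under isomorphisms, and so is the real quadratic form
   (a^2)_0 = sum_x (-1)^q(x) a_x^2; by Sylvester's law of inertia the number of zeros of q is an
   invariant. These two numbers determine q up to equivalence: split off hyperbolic planes until
   q has no zero outside the radical of B; what remains is the radical, or the orthogonal sum
   of an anisotropic plane and a radical on which q vanishes. *)

theory Submission
  imports Defs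
begin

section \<open>Bits and bilinear forms\<close>

(* These default rules rewrite sums and products of bits to xor and and, out of reach of the ring
   simplification rules. *)
declare add_bit_eq_xor [simp del] mult_bit_eq_and [simp del]

lemma bit_add_self [simp]: "a + a = (0 :: bit)"
  by (cases a) simp_all

lemma bit_add_eq_0_iff: "a + b = 0 \<longleftrightarrow> a = (b :: bit)"
  by (cases a; cases b) simp_all

lemma bit_vec_add_self [simp]: "x + x = (0 :: bit ^ 'n)"
  by (simp add: vec_eq_iff)

lemma bit_vec_add_left_self [simp]: "x + (x + y) = (y :: bit ^ 'n)"
  by (simp flip: add.assoc)

lemma bit_vec_add_eq_0_iff: "x + y = 0 \<longleftrightarrow> x = (y :: bit ^ 'n)"
  by (simp add: vec_eq_iff bit_add_eq_0_iff)

text \<open>The only scalars are 0 and 1, so homogeneity follows from additivity.\<close>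

lemma linear_bit_vec_iff:
  fixes T :: "bit ^ 'm \<Rightarrow> bit ^ 'n"
  shows "Vector_Spaces.linear (*s) (*s) T \<longleftrightarrow> (\<forall>x y. T (x + y) = T x + T y)"
proof
  assume add: "\<forall>x y. T (x + y) = T x + T y"
  then have "T 0 = 0"
    by (metis add_cancel_left_right)
  then have "T (c *s x) = c *s T x" for c x
    by (cases c) simp_all
  with add show "Vector_Spaces.linear (*s) (*s) T"
    unfolding Vector_Spaces.linear_def module_hom_def module_hom_axioms_def
    by (simp add: vec.vector_space_axioms vec.module_axioms)
qed (simp add: Vector_Spaces.linear_def module_hom_def module_hom_axioms_def)

lemma subspace_bit_iff:
  fixes S :: "(bit ^ 'n) set"
  shows "vec.subspace S \<longleftrightarrow> 0 \<in> S \<and> (\<forall>x\<in>S. \<forall>y\<in>S. x + y \<in> S)"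
proof -
  have "c *s x \<in> S" if "0 \<in> S" "x \<in> S" for c x
    using that by (cases c) simp_all
  then show ?thesis
    unfolding vec.subspace_def by blast
qed

lemma sign_bit_simps [simp]: "sign_bit 0 = 1" "sign_bit 1 = - 1"
  by (simp_all add: sign_bit_def)

lemma sign_bit_add: "sign_bit (a + b) = sign_bit a * sign_bit b"
  by (cases a; cases b) simp_all

lemma sign_bit_square [simp]: "sign_bit a * sign_bit a = 1"
  by (cases a) simp_all

lemma sign_bit_eq_iff: "sign_bit a = sign_bit b \<longleftrightarrow> a = b"
  by (cases a; cases b) simp_all

lemma bilinear_form_add:
  assumes "bilinear_form f"
  shows "f (x + y) z = f x z + f y z" and "f z (x + y) = f z x + f z y"
  using assms unfolding bilinear_form_def Vector_Spaces.linear_def module_hom_def module_hom_axioms_def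
  by blast+

lemma bilinear_form_0:
  assumes "bilinear_form f"
  shows "f 0 z = 0" and "f z 0 = 0"
  using bilinear_form_add[OF assms, of 0 0 z] bilinear_form_add[OF assms, of z 0 0] by simp_all

lemma bilinear_formI:
  assumes "\<And>x y z. f (x + y) z = f x z + f y z" and "\<And>x y z. f z (x + y) = f z x + f z y"
  shows "bilinear_form f"
proof -
  have "f 0 z = 0" "f z 0 = 0" for z
    using assms(1)[of 0 0 z] assms(2)[of z 0 0] by simp_all
  then have "f (c *s x) z = c * f x z" "f z (c *s x) = c * f z x" for c x z
    by (cases c; simp)+
  moreover have "vector_space ((*) :: bit \<Rightarrow> bit \<Rightarrow> bit)"
    by unfold_locales (simp_all add: algebra_simps)
  ultimately show ?thesis
    unfolding bilinear_form_def Vector_Spaces.linear_def module_hom_def module_hom_axioms_def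
    using assms by (simp add: vec.vector_space_axioms vec.module_axioms module_iff_vector_space)
qed

text \<open>An alternating matrix is the sum of its strictly upper triangular part \<open>E\<close>
  and the transpose of \<open>E\<close>. Hence \<open>D\<close> is the polar form of
  \<open>E x x\<close>, which serves as \<open>g\<close>; halving \<open>D x x\<close> is impossible
  in characteristic 2.\<close>

lemma alternating_form_eq_polar:
  fixes D :: "(bit, 'n::{finite,linorder}) vec \<Rightarrow> (bit, 'n) vec \<Rightarrow> bit"
  assumes "bilinear_form D" and alt: "\<And>x. D x x = 0"
  obtains g where "\<And>x y. g (x + y) = g x + g y + D x y"
proof
  define d where "d i j = D (axis i 1) (axis j 1)" for i j :: 'n
  define E where "E x y = (\<Sum>i\<in>UNIV. \<Sum>j\<in>UNIV. (if i < j then d i j else 0) * x $ i * y $ j)"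
    for x y :: "(bit, 'n) vec"
  \<comment> \<open>Symmetry comes from expanding \<open>D (x + y) (x + y) = 0\<close>.\<close>
  have sym: "d i j = d j i" for i j
  proof -
    let ?x = "axis i 1 :: (bit, 'n) vec" and ?y = "axis j 1 :: (bit, 'n) vec"
    have "D (?x + ?y) (?x + ?y) = D ?x ?x + D ?x ?y + (D ?y ?x + D ?y ?y)"
      by (simp only: bilinear_form_add[OF assms(1)] ac_simps)
    then show ?thesis
      by (simp add: alt d_def bit_add_eq_0_iff eq_commute[of 0])
  qed
  have "E y x = (\<Sum>i\<in>UNIV. \<Sum>j\<in>UNIV. (if j < i then d i j else 0) * x $ i * y $ j)" for x y
    unfolding E_def by (subst sum.swap) (auto intro!: sum.cong simp: sym ac_simps)
  then have "E x y + E y x = (\<Sum>i\<in>UNIV. \<Sum>j\<in>UNIV.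
      (if i < j then d i j else 0) * x $ i * y $ j + (if j < i then d i j else 0) * x $ i * y $ j)" for x y
    by (simp only: sum.distrib E_def)
  moreover have "(if i < j then d i j else 0) * x $ i * y $ j + (if j < i then d i j else 0) * x $ i * y $ j
      = d i j * x $ i * y $ j" for x y :: "(bit, 'n) vec" and i j
  proof -
    have "d i i = 0"
      by (simp add: d_def alt)
    then show ?thesis
      by (cases i j rule: linorder_cases) simp_all
  qed
  ultimately have "E x y + E y x = (\<Sum>i\<in>UNIV. \<Sum>j\<in>UNIV. d i j * x $ i * y $ j)" for x y
    by simp
  then have D: "D x y = E x y + E y x" for x y
    using bilinear_form_eq_sum[OF assms(1), of x y] by (simp add: d_def)
  have "E (x + y) z = E x z + E y z" "E z (x + y) = E z x + E z y" for x y z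
    unfolding E_def by (simp_all only: vector_add_component distrib_left distrib_right sum.distrib)
  then show "E (x + y) (x + y) = E x x + E y y + D x y" for x y
    by (simp only: D add.assoc add.commute add.left_commute)
qed

section \<open>Isometries induce isomorphisms\<close>

text \<open>Since \<open>-x = x\<close>, the pairs of indices with sum \<open>z\<close> are exactly
  \<open>(x, x + z)\<close>.\<close>

lemma twisted_mult_nth:
  "twisted_mult f a b $ z = (\<Sum>x\<in>UNIV. a $ x * b $ (x + z) * sign_bit (f x (x + z)))"
proof -
  have "(a $ x * b $ y * sign_bit (f x y)) * axis (x + y) 1 $ z
      = (if y = x + z then a $ x * b $ y * sign_bit (f x y) else 0)" for x y
    by (auto simp: axis_def)
  then show ?thesis
    unfolding twisted_mult_def by simp
qed

text \<open>Pulled back along \<open>T\<close>, the cocycle \<open>f1\<close> has the same diagonal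
  as \<open>f2\<close>, so the two differ by an alternating form \<open>D\<close>. This is the
  coboundary of \<open>g\<close>, and rescaling the basis by the signs of \<open>g\<close> absorbs
  it.\<close>

lemma algebra_isomorphic_if_isometry:
  fixes f1 f2 :: "(bit, 'n::{finite,linorder}) vec \<Rightarrow> (bit, 'n) vec \<Rightarrow> bit"
  assumes f: "bilinear_form f1" "bilinear_form f2"
    and T: "Vector_Spaces.linear (*s) (*s) T" "bij T" and q: "\<And>x. f2 x x = f1 (T x) (T x)"
  shows "algebra_isomorphic (twisted_mult f1) (twisted_mult f2)"
proof -
  define D where "D x y = f1 (T x) (T y) + f2 x y" for x y
  have T_add: "T (x + y) = T x + T y" for x y
    using T(1) by (simp add: linear_bit_vec_iff)
  have "bilinear_form D"
    by (rule bilinear_formI) (simp_all add: D_def T_add bilinear_form_add f ac_simps)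
  moreover have "D x x = 0" for x
    by (simp add: D_def q)
  ultimately obtain g where g: "g (x + y) = g x + g y + D x y" for x y
    using alternating_form_eq_polar by metis
  define \<phi> where "\<phi> a = (\<chi> y. a $ T y * sign_bit (g y))" for a :: "real ^ ((bit, 'n) vec)"
  define \<psi> where "\<psi> b = (\<chi> x. b $ inv T x * sign_bit (g (inv T x)))" for b :: "real ^ ((bit, 'n) vec)"
  have "linear \<phi>"
    by (auto simp: linear_iff \<phi>_def vec_eq_iff algebra_simps)
  moreover have "bij \<phi>"
  proof (rule bij_betw_byWitness)
    show "\<forall>a\<in>UNIV. \<psi> (\<phi> a) = a" "\<forall>b\<in>UNIV. \<phi> (\<psi> b) = b"
      using T(2) by (simp_all add: \<phi>_def \<psi>_def vec_eq_iff bij_is_inj bij_is_surj surj_f_inv_f)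
  qed auto
  moreover have "\<phi> (twisted_mult f1 a b) = twisted_mult f2 (\<phi> a) (\<phi> b)" for a b
  proof -
    have "\<phi> (twisted_mult f1 a b) $ z = twisted_mult f2 (\<phi> a) (\<phi> b) $ z" for z
    proof -
      have "\<phi> (twisted_mult f1 a b) $ z =
          (\<Sum>x\<in>UNIV. a $ x * b $ (x + T z) * (sign_bit (f1 x (x + T z)) * sign_bit (g z)))"
        by (simp add: \<phi>_def twisted_mult_nth sum_distrib_right mult.assoc)
      also have "\<dots> = (\<Sum>y\<in>UNIV. a $ T y * b $ (T y + T z) *
          (sign_bit (f1 (T y) (T y + T z)) * sign_bit (g z)))"
        by (rule sum.reindex_bij_betw[OF T(2), symmetric])
      also have "\<dots> = twisted_mult f2 (\<phi> a) (\<phi> b) $ z"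
        unfolding twisted_mult_nth
      proof (rule sum.cong)
        fix y
        \<comment> \<open>The coboundary identity is used for \<open>y\<close> and
          \<open>y + z\<close>, whose sum is \<open>z\<close>.\<close>
        have "g z = g y + g (y + z) + D y (y + z)"
          using g[of y "y + z"] by simp
        then have "f1 (T y) (T y + T z) + g z = g y + g (y + z) + f2 y (y + z)"
          by (simp add: D_def T_add ac_simps)
        then have "sign_bit (f1 (T y) (T y + T z)) * sign_bit (g z) =
            sign_bit (g y) * sign_bit (g (y + z)) * sign_bit (f2 y (y + z))"
          by (simp flip: sign_bit_add)
        then show "a $ T y * b $ (T y + T z) * (sign_bit (f1 (T y) (T y + T z)) * sign_bit (g z)) =
            \<phi> a $ y * \<phi> b $ (y + z) * sign_bit (f2 y (y + z))"
          by (simp add: \<phi>_def T_add)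
      qed simp
      finally show ?thesis .
    qed
    then show ?thesis
      by (simp add: vec_eq_iff)
  qed
  ultimately show ?thesis
    unfolding algebra_isomorphic_def by blast
qed

section \<open>Classification of binary quadratic forms\<close>

lemma UNIV_bit: "UNIV = {0, 1 :: bit}"
  by (auto intro: bit.exhaust)

lemma card_UNIV_bit: "CARD(bit) = 2"
  unfolding UNIV_bit by simp

text \<open>Equal cardinality forces equal dimension: if \<open>V\<close> had smaller dimension than
  \<open>V'\<close>, some proper subspace \<open>W\<close> of \<open>V'\<close> would be isomorphic
  to \<open>V\<close>, hence as large as the finite set \<open>V'\<close>.\<close>

lemma subspace_isomorphic_if_card_eq:
  fixes S S' :: "(bit ^ 'n) set"
  assumes S: "vec.subspace S" "vec.subspace S'" and card: "card S = card S'"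
  obtains T where "bij_betw T S S'" "\<And>x y. T (x + y) = T x + T y"
proof -
  have *: "vec.dim V' \<le> vec.dim V"
    if V: "vec.subspace V" "vec.subspace V'" "card V = card V'" for V V' :: "(bit ^ 'n) set"
  proof (rule ccontr)
    assume less: "\<not> vec.dim V' \<le> vec.dim V"
    obtain W where W: "vec.subspace W" "W \<subseteq> vec.span V'" "vec.dim W = vec.dim V"
      using vec.choose_subspace_of_subspace[of "vec.dim V" V'] less by (metis nle_le)
    then obtain T where "T ` V = W" "inj_on T V"
      using vec.subspace_isomorphism[of V W] V(1) by metis
    then have "card W = card V'"
      using card_image V(3) by metis
    moreover have "W \<subseteq> V'"
      using W(2) V(2) by (metis vec.span_eq_iff)
    ultimately have "W = V'"
      by (simp add: card_subset_eq)
    then show False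
      using less W(3) by simp
  qed
  have "vec.dim S = vec.dim S'"
    using *[OF S card] *[OF S(2,1) card[symmetric]] by simp
  from vec.subspace_isomorphism[OF S this] obtain T
    where "Vector_Spaces.linear (*s) (*s) T" "T ` S = S'" "inj_on T S"
    by blast
  then show ?thesis
    using that by (auto simp: bij_betw_def linear_bit_vec_iff)
qed

section \<open>Radical, Gauss sum and isometry of forms on subspaces\<close>

definition radical_on :: "('a \<Rightarrow> 'a \<Rightarrow> bit) \<Rightarrow> 'a set \<Rightarrow> 'a set" where
  "radical_on B S = {z\<in>S. \<forall>w\<in>S. B z w = 0}"

definition orthogonal_in :: "('a \<Rightarrow> 'a \<Rightarrow> bit) \<Rightarrow> 'a set \<Rightarrow> 'a \<Rightarrow> 'a \<Rightarrow> 'a set" where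
  "orthogonal_in B S x y = {z\<in>S. B x z = 0 \<and> B y z = 0}"

text \<open>The Gauss sum: zeros of \<open>q\<close> minus ones. It carries the same information as
  the number of zeros, but is multiplicative over orthogonal sums.\<close>

definition sign_sum :: "('a \<Rightarrow> bit) \<Rightarrow> 'a set \<Rightarrow> real" where
  "sign_sum q S = (\<Sum>z\<in>S. sign_bit (q z))"

text \<open>Relative to sets, so that an induction can pass to subspaces of a fixed space. On
  subspaces, additivity amounts to linearity.\<close>

definition isometric_on ::
  "('a::plus \<Rightarrow> bit) \<Rightarrow> 'a set \<Rightarrow> ('b::plus \<Rightarrow> bit) \<Rightarrow> 'b set \<Rightarrow> bool" where
  "isometric_on q S q' S' \<longleftrightarrow>
     (\<exists>T. bij_betw T S S' \<and> (\<forall>x\<in>S. \<forall>y\<in>S. T (x + y) = T x + T y) \<and> (\<forall>x\<in>S. q' (T x) = q x))"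

text \<open>A coordinate-free quadratic form. As \<open>q_add\<close> makes \<open>B\<close> the
  polar form of \<open>q\<close>, symmetry, alternation and additivity in the second argument
  follow.\<close>

locale binary_quadratic_form =
  fixes q :: "bit ^ 'n \<Rightarrow> bit" and B :: "bit ^ 'n \<Rightarrow> bit ^ 'n \<Rightarrow> bit"
  assumes q_add: "q (x + y) = q x + q y + B x y"
    and B_add_left: "B (x + y) z = B x z + B y z"
begin

lemma B_eq: "B x y = q (x + y) + q x + q y"
  by (simp add: q_add ac_simps)

lemma B_commute: "B x y = B y x"
  by (simp add: B_eq ac_simps)

lemma B_add_right: "B z (x + y) = B z x + B z y"
  using B_add_left[of x y z] by (simp only: B_commute[of z])

lemma B_0 [simp]: "B 0 z = 0" "B z 0 = 0"
  using B_add_left[of 0 0 z] B_add_right[of z 0 0] by simp_all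

lemma q_0 [simp]: "q 0 = 0"
  using q_add[of 0 0] by simp

lemma B_self [simp]: "B x x = 0"
  by (simp add: B_eq)

lemma B_scale [simp]: "B (c *s x) z = c * B x z" "B z (c *s x) = c * B z x"
  by (cases c; simp)+

lemma q_scale [simp]: "q (c *s x) = c * q x"
  by (cases c) simp_all

lemma subspace_orthogonal:
  assumes "vec.subspace S"
  shows "vec.subspace (orthogonal_in B S x y)"
  using assms by (simp add: subspace_bit_iff orthogonal_in_def B_add_right)

lemma subspace_radical:
  assumes "vec.subspace S"
  shows "vec.subspace (radical_on B S)"
  using assms by (simp add: subspace_bit_iff radical_on_def B_add_left)

section \<open>Splitting off the nondegenerate plane spanned by \<open>x\<close> and
  \<open>y\<close>\<close>

context
  fixes S x y
  assumes S: "vec.subspace S" and x: "x \<in> S" and y: "y \<in> S" and B_1: "B x y = 1"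
begin

lemma B_1_commute: "B y x = 1"
  using B_1 by (simp only: B_commute[of y x])

definition join :: "bit \<times> bit \<times> (bit ^ 'n) \<Rightarrow> bit ^ 'n" where
  "join = (\<lambda>(c, d, w). c *s x + d *s y + w)"

text \<open>As \<open>B x y = 1\<close> and \<open>B\<close> is alternating, pairing with
  \<open>y\<close> reads off the coefficient of \<open>x\<close>, and pairing with \<open>x\<close>
  that of \<open>y\<close>. Adding the plane component removes it.\<close>

definition split_off :: "bit ^ 'n \<Rightarrow> bit \<times> bit \<times> (bit ^ 'n)" where
  "split_off z = (B z y, B z x, B z y *s x + B z x *s y + z)"

lemma split_off_in: "z \<in> S \<Longrightarrow> split_off z \<in> UNIV \<times> UNIV \<times> orthogonal_in B S x y"
  using S x y B_1 B_1_commute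
  by (auto simp: split_off_def orthogonal_in_def B_add_right B_commute intro!: vec.subspace_add vec.subspace_scale)

lemma join_in: "p \<in> UNIV \<times> UNIV \<times> orthogonal_in B S x y \<Longrightarrow> join p \<in> S"
  using S x y
  by (auto simp: join_def orthogonal_in_def intro!: vec.subspace_add vec.subspace_scale)

lemma join_split_off: "join (split_off z) = z"
  by (simp add: join_def split_off_def)

lemma split_off_join: "p \<in> UNIV \<times> UNIV \<times> orthogonal_in B S x y \<Longrightarrow> split_off (join p) = p"
  using B_1 B_1_commute
  by (auto simp: join_def split_off_def orthogonal_in_def B_add_left B_add_right B_commute)

lemma bij_betw_join: "bij_betw join (UNIV \<times> UNIV \<times> orthogonal_in B S x y) S"
  by (intro bij_betw_byWitness[where f' = split_off] ballI image_subsetI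
      split_off_join join_split_off join_in split_off_in)

lemma bij_betw_split_off: "bij_betw split_off S (UNIV \<times> UNIV \<times> orthogonal_in B S x y)"
  by (intro bij_betw_byWitness[where f' = join] ballI image_subsetI
      split_off_join join_split_off join_in split_off_in)

lemma q_join:
  assumes "w \<in> orthogonal_in B S x y"
  shows "q (join (c, d, w)) = c * q x + d * q y + c * d + q w"
  using assms B_1 by (simp add: join_def q_add B_add_left orthogonal_in_def)

lemma split_off_add: "split_off (u + v) = split_off u + split_off v"
  by (simp add: split_off_def B_add_left vec.scale_left_distrib ac_simps)

lemma join_add: "join (p + r) = join p + join r"
  by (cases p; cases r) (simp add: join_def vec.scale_left_distrib ac_simps)

lemma card_split: "card S = 4 * card (orthogonal_in B S x y)"
  using bij_betw_same_card[OF bij_betw_join] by (simp add: card_cartesian_product card_UNIV_bit)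

text \<open>The factor is the Gauss sum of the plane, with one term for each of 0, \<open>x\<close>,
  \<open>y\<close> and \<open>x + y\<close>. It is -2 if \<open>q x = q y = 1\<close> and 2
  otherwise.\<close>

lemma sign_sum_split:
  "sign_sum q S = (1 + sign_bit (q x) + sign_bit (q y) - sign_bit (q x) * sign_bit (q y)) *
     sign_sum q (orthogonal_in B S x y)"
proof -
  let ?O = "orthogonal_in B S x y"
  have "sign_sum q S = (\<Sum>p\<in>UNIV \<times> UNIV \<times> ?O. sign_bit (q (join p)))"
    unfolding sign_sum_def by (rule sum.reindex_bij_betw[OF bij_betw_join, symmetric])
  also have "\<dots> = (\<Sum>c\<in>UNIV. \<Sum>d\<in>UNIV. \<Sum>w\<in>?O. sign_bit (q (join (c, d, w))))"
    by (simp add: sum.cartesian_product)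
  also have "\<dots> = (\<Sum>c\<in>UNIV. \<Sum>d\<in>UNIV. \<Sum>w\<in>?O.
      sign_bit (c * q x + d * q y + c * d) * sign_bit (q w))"
    by (simp add: q_join sign_bit_add)
  also have "\<dots> = (\<Sum>c\<in>UNIV. \<Sum>d\<in>UNIV. sign_bit (c * q x + d * q y + c * d) * sign_sum q ?O)"
    by (simp only: sign_sum_def sum_distrib_left)
  also have "\<dots> = (\<Sum>c\<in>UNIV. \<Sum>d\<in>UNIV. sign_bit (c * q x + d * q y + c * d)) * sign_sum q ?O"
    by (simp only: sum_distrib_right)
  also have "(\<Sum>c\<in>UNIV. \<Sum>d\<in>UNIV. sign_bit (c * q x + d * q y + c * d)) =
      1 + sign_bit (q x) + sign_bit (q y) - sign_bit (q x) * sign_bit (q y)"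
    by (simp add: UNIV_bit sign_bit_add)
  finally show ?thesis .
qed

text \<open>A vector orthogonal to \<open>x\<close>, to \<open>y\<close> and to their orthogonal
  complement is orthogonal to all of \<open>S\<close>, because these generate
  \<open>S\<close>.\<close>

lemma radical_split: "radical_on B (orthogonal_in B S x y) = radical_on B S"
proof (intro equalityI subsetI)
  fix z assume z: "z \<in> radical_on B (orthogonal_in B S x y)"
  have "B z u = 0" if u: "u \<in> S" for u
  proof -
    obtain c d w where p: "split_off u = (c, d, w)" "w \<in> orthogonal_in B S x y"
      using split_off_in[OF u] by (metis mem_Sigma_iff prod_cases3)
    then have "u = c *s x + d *s y + w"
      using join_split_off[of u] by (simp add: join_def)
    then show ?thesis
      using z p(2) by (simp add: radical_on_def orthogonal_in_def B_add_right B_commute)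
  qed
  then show "z \<in> radical_on B S"
    using z by (simp add: radical_on_def orthogonal_in_def)
qed (use x y in \<open>auto simp: radical_on_def orthogonal_in_def B_commute\<close>)

end

text \<open>On its radical \<open>q\<close> is additive, so translation by some \<open>u\<close>
  with \<open>q u = 1\<close> flips every sign and the sum equals its own negative.\<close>

lemma sign_sum_radical:
  assumes S: "vec.subspace S" "S \<subseteq> radical_on B S"
  shows "sign_sum q S = (if \<forall>u\<in>S. q u = 0 then real (card S) else 0)"
proof (cases "\<forall>u\<in>S. q u = 0")
  case False
  then obtain u where u: "u \<in> S" "q u = 1"
    by auto
  have "sign_sum q S = (\<Sum>z\<in>S. sign_bit (q (u + z)))"
    unfolding sign_sum_def
    by (rule sum.reindex_bij_witness[of _ "\<lambda>z. u + z" "\<lambda>z. u + z"]) (use S u in \<open>auto simp: vec.subspace_add\<close>)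
  also have "\<dots> = (\<Sum>z\<in>S. - sign_bit (q z))"
    by (rule sum.cong) (use u S in \<open>auto simp: q_add sign_bit_add radical_on_def\<close>)
  also have "\<dots> = - sign_sum q S"
    by (simp add: sum_negf sign_sum_def)
  finally have "sign_sum q S = 0"
    by simp
  then show ?thesis
    using False by (simp only: if_False)
qed (simp add: sign_sum_def)

text \<open>The cases are whether \<open>q\<close> has a zero outside the radical. This is the step
  that reduces a form to a smaller one or recognizes the final anisotropic plane.\<close>

lemma hyperbolic_or_anisotropic:
  assumes S: "vec.subspace S" and nontrivial: "radical_on B S \<noteq> S"
  obtains (hyperbolic) x y where "x \<in> S" "y \<in> S" "B x y = 1" "q x = 0" "q y = 0"
  | (anisotropic) x y where "x \<in> S" "y \<in> S" "B x y = 1" "q x = 1" "q y = 1"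
      "orthogonal_in B S x y = radical_on B S" "\<forall>z\<in>radical_on B S. q z = 0"
proof (cases "\<exists>x\<in>S. x \<notin> radical_on B S \<and> q x = 0")
  case True
  then obtain x y where xy: "x \<in> S" "y \<in> S" "B x y = 1" "q x = 0"
    by (auto simp: radical_on_def)
  show ?thesis
  proof (cases "q y = 0")
    case True
    then show ?thesis
      by (rule hyperbolic[OF xy(1-4)])
  next
    case False
    \<comment> \<open>Replacing \<open>y\<close> by \<open>x + y\<close> changes
      \<open>q y = 1\<close> by \<open>q x + B x y = 1\<close>.\<close>
    then have "q (x + y) = 0" "B x (x + y) = 1"
      using xy by (simp_all add: q_add B_add_right)
    then show ?thesis
      using hyperbolic[OF xy(1) vec.subspace_add[OF S xy(1,2)] _ xy(4)] by blast
  qed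
next
  case False
  have q_1: "q u = 1" if "u \<in> S" "v \<in> S" "B u v = 1" for u v
  proof -
    have "u \<notin> radical_on B S"
      using that by (auto simp: radical_on_def)
    then have "q u \<noteq> 0"
      using False that(1) by blast
    then show ?thesis
      by simp
  qed
  have "radical_on B S \<subseteq> S"
    by (auto simp: radical_on_def)
  then obtain x where "x \<in> S" "x \<notin> radical_on B S"
    using nontrivial by blast
  then obtain y where xy: "x \<in> S" "y \<in> S" "B x y = 1"
    by (auto simp: radical_on_def)
  have "B y x = 1"
    using xy(3) by (simp only: B_commute[of x y])
  then have y_1: "q y = 1"
    by (rule q_1[OF xy(2,1)])
  \<comment> \<open>The vector \<open>x + z\<close> still pairs to 1 with \<open>y\<close>, so
    \<open>q (x + z) = 1\<close>; but orthogonality gives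
    \<open>q (x + z) = 1 + q z\<close>.\<close>
  have q_zero: "q z = 0" if z: "z \<in> S" "B x z = 0" "B y z = 0" for z
  proof -
    have "B z y = 0"
      using z(3) by (simp only: B_commute[of y z])
    then have "B (x + z) y = 1"
      using xy(3) by (simp add: B_add_left)
    then have "q (x + z) = 1"
      by (rule q_1[OF vec.subspace_add[OF S xy(1) z(1)] xy(2)])
    then show ?thesis
      using q_1[OF xy] z by (simp add: q_add)
  qed
  have "orthogonal_in B S x y = radical_on B S"
  proof (intro equalityI subsetI)
    fix z assume z: "z \<in> orthogonal_in B S x y"
    then have "z \<in> S" "q z = 0"
      using q_zero by (simp_all add: orthogonal_in_def)
    then show "z \<in> radical_on B S"
      using False by blast
  qed (use xy in \<open>simp add: radical_on_def orthogonal_in_def B_commute\<close>)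
  moreover have "\<forall>z\<in>radical_on B S. q z = 0"
    using q_zero xy by (simp add: radical_on_def B_commute)
  ultimately show ?thesis
    by (rule anisotropic[OF xy q_1[OF xy] y_1])
qed

text \<open>Since \<open>q\<close> is additive on \<open>S\<close>, translation by \<open>x\<close>
  swaps its zeros and its ones.\<close>

lemma card_kernel:
  assumes S: "vec.subspace S" "S \<subseteq> radical_on B S" and x: "x \<in> S" "q x = 1"
  shows "card S = 2 * card {z\<in>S. q z = 0}"
proof -
  have q_add': "q (x + z) = 1 + q z" if "z \<in> S" for z
    using that S x by (auto simp: q_add radical_on_def)
  have "bij_betw (\<lambda>z. x + z) {z\<in>S. q z = 0} {z\<in>S. q z = 1}"
    by (rule bij_betw_byWitness[where f' = "\<lambda>z. x + z"])
      (use S x in \<open>auto simp: vec.subspace_add q_add'\<close>)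
  from bij_betw_same_card[OF this] have "card {z\<in>S. q z = 1} = card {z\<in>S. q z = 0}"
    by (rule sym)
  moreover have "{z\<in>S. q z = 0} \<union> {z\<in>S. q z = 1} = S"
    by auto
  then have "card S = card {z\<in>S. q z = 0} + card {z\<in>S. q z = 1}"
    by (subst card_Un_disjoint[symmetric]) auto
  ultimately show ?thesis
    by simp
qed

text \<open>The hypotheses on \<open>S\<close> are the invariants of the anisotropic case. With
  \<open>q x = q y = 0\<close> the complement of the plane would be the radical, by cardinality, and
  the Gauss sum would be twice a nonnegative number.\<close>

lemma not_hyperbolic:
  assumes S: "vec.subspace S" and card: "card S = 4 * card (radical_on B S)"
    and sum: "sign_sum q S < 0" and xy: "x \<in> S" "y \<in> S" "B x y = 1" "q x = 0"
  shows "q y = 1"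
proof (rule ccontr)
  assume "q y \<noteq> 1"
  then have "sign_sum q S = 2 * sign_sum q (orthogonal_in B S x y)"
    using sign_sum_split[OF S xy(1-3)] xy(4) by simp
  moreover have "radical_on B S \<subseteq> orthogonal_in B S x y"
    using xy by (auto simp: radical_on_def orthogonal_in_def B_commute)
  then have "orthogonal_in B S x y = radical_on B S"
    using card card_split[OF S xy(1-3)] by (metis card_subset_eq finite mult_cancel1 zero_neq_numeral)
  moreover have "sign_sum q (radical_on B S) \<ge> 0"
    by (subst sign_sum_radical[OF subspace_radical[OF S]]) (auto simp: radical_on_def)
  ultimately show False
    using sum by simp
qed

end

text \<open>Extend the isometry \<open>T\<close> of the complements by sending \<open>x\<close> to
  \<open>x'\<close> and \<open>y\<close> to \<open>y'\<close>. By \<open>q_join\<close>, the form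
  depends only on the plane coordinates, the values at \<open>x\<close> and \<open>y\<close>, and
  the value on the complement.\<close>

lemma isometric_on_orthogonal_sum:
  assumes "binary_quadratic_form q B" "binary_quadratic_form q' B'"
    and xy: "vec.subspace S" "x \<in> S" "y \<in> S" "B x y = 1"
    and xy': "vec.subspace S'" "x' \<in> S'" "y' \<in> S'" "B' x' y' = 1"
    and q: "q' x' = q x" "q' y' = q y"
    and iso: "isometric_on q (orthogonal_in B S x y) q' (orthogonal_in B' S' x' y')"
  shows "isometric_on q S q' S'"
proof -
  interpret Q: binary_quadratic_form q B by fact
  interpret Q': binary_quadratic_form q' B' by fact
  obtain T where T: "bij_betw T (orthogonal_in B S x y) (orthogonal_in B' S' x' y')"
    and T_add: "\<And>u v. u \<in> orthogonal_in B S x y \<Longrightarrow> v \<in> orthogonal_in B S x y \<Longrightarrow> T (u + v) = T u + T v"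
    and T_q: "\<And>u. u \<in> orthogonal_in B S x y \<Longrightarrow> q' (T u) = q u"
    using iso unfolding isometric_on_def by blast
  define M where "M = map_prod (id :: bit \<Rightarrow> bit) (map_prod (id :: bit \<Rightarrow> bit) T)"
  define R where "R z = Q'.join x' y' (M (Q.split_off x y z))" for z
  have "bij_betw M (UNIV \<times> UNIV \<times> orthogonal_in B S x y) (UNIV \<times> UNIV \<times> orthogonal_in B' S' x' y')"
    unfolding M_def by (intro bij_betw_map_prod bij_betw_id T)
  then have "bij_betw R S S'"
    unfolding R_def using Q.bij_betw_split_off[OF xy] Q'.bij_betw_join[OF xy']
    by (auto intro: bij_betw_trans[unfolded comp_def])
  moreover have "R (u + v) = R u + R v" if "u \<in> S" "v \<in> S" for u v
  proof -
    have "M (p + r) = M p + M r"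
      if "p \<in> UNIV \<times> UNIV \<times> orthogonal_in B S x y" "r \<in> UNIV \<times> UNIV \<times> orthogonal_in B S x y" for p r
      using that by (auto simp: M_def T_add)
    then show ?thesis
      using Q.split_off_in[OF xy] that
      by (simp add: R_def Q.split_off_add[OF xy] Q'.join_add[OF xy'])
  qed
  moreover have "q' (R u) = q u" if u: "u \<in> S" for u
  proof -
    obtain c d w where p: "Q.split_off x y u = (c, d, w)" "w \<in> orthogonal_in B S x y"
      using Q.split_off_in[OF xy u] by (metis mem_Sigma_iff prod_cases3)
    then have "T w \<in> orthogonal_in B' S' x' y'"
      using T by (auto simp: bij_betw_def)
    then have "q' (R u) = c * q x + d * q y + c * d + q w"
      by (simp add: R_def M_def p Q'.q_join[OF xy'] T_q q)
    also have "\<dots> = q (Q.join x y (c, d, w))"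
      by (rule Q.q_join[OF xy p(2), symmetric])
    also have "\<dots> = q u"
      using Q.join_split_off[OF xy, of u] p(1) by simp
    finally show ?thesis .
  qed
  ultimately show ?thesis
    unfolding isometric_on_def by blast
qed

text \<open>Here both forms are additive, and the Gauss sum tells whether they vanish. If not, their
  kernels have index 2, and a linear bijection of the kernels extends by matching one vector outside
  each.\<close>

lemma isometric_on_radical:
  fixes q q' :: "bit ^ 'n \<Rightarrow> bit"
  assumes "binary_quadratic_form q B" "binary_quadratic_form q' B'"
    and S: "vec.subspace S" "S \<subseteq> radical_on B S" and S': "vec.subspace S'" "S' \<subseteq> radical_on B' S'"
    and card: "card S = card S'" and sum: "sign_sum q S = sign_sum q' S'"
  shows "isometric_on q S q' S'"
proof -
  interpret Q: binary_quadratic_form q B by fact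
  interpret Q': binary_quadratic_form q' B' by fact
  have "card S > 0"
    using S(1) vec.subspace_0 by (auto simp: card_gt_0_iff)
  then have zero_iff: "(\<forall>u\<in>S. q u = 0) \<longleftrightarrow> (\<forall>u\<in>S'. q' u = 0)"
    using sum card Q.sign_sum_radical[OF S] Q'.sign_sum_radical[OF S']
    by (auto split: if_splits)
  show ?thesis
  proof (cases "\<forall>u\<in>S. q u = 0")
    case True
    obtain T where "bij_betw T S S'" "\<And>x y. T (x + y) = T x + T y"
      using subspace_isomorphic_if_card_eq[OF S(1) S'(1) card] by metis
    then show ?thesis
      using True zero_iff unfolding isometric_on_def by (metis bij_betwE)
  next
    case False
    then obtain x where x: "x \<in> S" "q x = 1"
      by auto
    obtain x' where x': "x' \<in> S'" "q' x' = 1"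
      using False zero_iff by auto
    define K where "K = {z\<in>S. q z = 0}"
    define K' where "K' = {z\<in>S'. q' z = 0}"
    have q_add: "q (u + v) = q u + q v" if "u \<in> S" "v \<in> S" for u v
      using that S by (auto simp: Q.q_add radical_on_def)
    have q'_add: "q' (u + v) = q' u + q' v" if "u \<in> S'" "v \<in> S'" for u v
      using that S' by (auto simp: Q'.q_add radical_on_def)
    have "vec.subspace K" "vec.subspace K'"
      using S(1) S'(1) by (auto simp: subspace_bit_iff K_def K'_def q_add q'_add)
    moreover have "card K = card K'"
      using card Q.card_kernel[OF S x] Q'.card_kernel[OF S' x'] by (simp add: K_def K'_def)
    ultimately obtain T where T: "bij_betw T K K'" and T_add: "\<And>u v. T (u + v) = T u + T v"
      using subspace_isomorphic_if_card_eq by metis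
    \<comment> \<open>\<open>R\<close> sends \<open>x\<close> to \<open>x'\<close> and agrees with
      \<open>T\<close> on the kernel; \<open>q z *s x + z\<close> is the kernel component of
      \<open>z\<close>.\<close>
    define R where "R z = q z *s x' + T (q z *s x + z)" for z
    have K: "q z *s x + z \<in> K" if "z \<in> S" for z
      using that x S(1) by (cases "q z") (auto simp: K_def q_add vec.subspace_add)
    have TK: "T (q z *s x + z) \<in> S'" "q' (T (q z *s x + z)) = 0" if "z \<in> S" for z
      using K[OF that] T by (auto simp: bij_betw_def K'_def)
    have R: "R z \<in> S'" "q' (R z) = q z" if "z \<in> S" for z
      using TK[OF that] x' S'(1)
      by (auto simp: R_def q'_add vec.subspace_add vec.subspace_scale)
    have "inj_on R S"
    proof (rule inj_onI)
      fix u v assume uv: "u \<in> S" "v \<in> S" "R u = R v"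
      then have "q u = q v"
        using R by metis
      with uv(3) have "T (q u *s x + u) = T (q v *s x + v)"
        by (simp add: R_def)
      from inj_onD[OF bij_betw_imp_inj_on[OF T] this K[OF uv(1)] K[OF uv(2)]] show "u = v"
        using \<open>q u = q v\<close> by simp
    qed
    moreover from this have "R ` S = S'"
      using R by (intro card_subset_eq) (auto simp: card_image card)
    moreover have "R (u + v) = R u + R v" if "u \<in> S" "v \<in> S" for u v
      using that by (simp add: R_def q_add T_add vec.scale_left_distrib ac_simps)
    ultimately show ?thesis
      unfolding isometric_on_def bij_betw_def using R by blast
  qed
qed

text \<open>Induction on \<open>card S\<close>: splitting off planes of the same type divides both
  cardinalities by 4 and both Gauss sums by the same 2 or -2, and keeps the radicals. Thus the
  complements again have equal invariants.\<close>

theorem isometric_on_if_invariants_eq: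
  fixes q q' :: "bit ^ 'n \<Rightarrow> bit"
  assumes "binary_quadratic_form q B" "binary_quadratic_form q' B'"
    and "vec.subspace S" "vec.subspace S'" "card S = card S'"
    and "card (radical_on B S) = card (radical_on B' S')"
    and "sign_sum q S = sign_sum q' S'"
  shows "isometric_on q S q' S'"
  using assms(3-)
proof (induction "card S" arbitrary: S S' rule: less_induct)
  case less
  interpret Q: binary_quadratic_form q B by fact
  interpret Q': binary_quadratic_form q' B' by fact
  note S = \<open>vec.subspace S\<close> and S' = \<open>vec.subspace S'\<close>
  have sub: "radical_on B S \<subseteq> S" "radical_on B' S' \<subseteq> S'"
    by (auto simp: radical_on_def)
  have pos: "card (radical_on B S) > 0"
    using vec.subspace_0[OF Q.subspace_radical[OF S]] by (auto simp: card_gt_0_iff)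
  show ?case
  proof (cases "radical_on B S = S")
    case True
    then have "radical_on B' S' = S'"
      using less.prems sub by (intro card_subset_eq) auto
    then show ?thesis
      using isometric_on_radical[OF assms(1,2) S _ S'] less.prems True by auto
  next
    case False
    then have False': "radical_on B' S' \<noteq> S'"
      using less.prems sub by (metis card_subset_eq finite)
    \<comment> \<open>Both types of planes at once: \<open>a = 0\<close> is the hyperbolic one,
      \<open>a = 1\<close> the anisotropic one.\<close>
    have glue: ?thesis
      if xy: "x \<in> S" "y \<in> S" "B x y = 1" "q x = a" "q y = a"
        and xy': "x' \<in> S'" "y' \<in> S'" "B' x' y' = 1" "q' x' = a" "q' y' = a" for x y x' y' a
    proof (rule isometric_on_orthogonal_sum[OF assms(1,2) S xy(1-3) S' xy'(1-3)])
      let ?O = "orthogonal_in B S x y" and ?O' = "orthogonal_in B' S' x' y'"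
      note split = Q.card_split[OF S xy(1-3)] Q'.card_split[OF S' xy'(1-3)]
      have "card S > 0"
        using xy(1) by (auto simp: card_gt_0_iff)
      then have "card ?O < card S" "card ?O = card ?O'"
        using split less.prems by simp_all
      moreover have "sign_sum q ?O = sign_sum q' ?O'"
        using Q.sign_sum_split[OF S xy(1-3)] Q'.sign_sum_split[OF S' xy'(1-3)] less.prems xy xy'
        by (cases a) simp_all
      ultimately show "isometric_on q ?O q' ?O'"
        using less.prems Q.subspace_orthogonal[OF S] Q'.subspace_orthogonal[OF S']
        by (intro less.hyps) (simp_all add: Q.radical_split[OF S xy(1-3)] Q'.radical_split[OF S' xy'(1-3)])
    qed (use xy xy' in simp_all)
    \<comment> \<open>The form vanishes on the radical, which thus contributes its positive size to
      the Gauss sum, while the plane contributes -2.\<close>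
    have aniso: "card S = 4 * card (radical_on B S)" "sign_sum q S < 0"
      if "x \<in> S" "y \<in> S" "B x y = 1" "q x = 1" "q y = 1"
        "orthogonal_in B S x y = radical_on B S" "\<forall>z\<in>radical_on B S. q z = 0" for x y
      using that pos Q.card_split[OF S that(1-3)] Q.sign_sum_split[OF S that(1-3)]
      by (simp_all add: sign_sum_def)
    have aniso': "card S' = 4 * card (radical_on B' S')" "sign_sum q' S' < 0"
      if "x \<in> S'" "y \<in> S'" "B' x y = 1" "q' x = 1" "q' y = 1"
        "orthogonal_in B' S' x y = radical_on B' S'" "\<forall>z\<in>radical_on B' S'. q' z = 0" for x y
      using that pos less.prems Q'.card_split[OF S' that(1-3)] Q'.sign_sum_split[OF S' that(1-3)]
      by (simp_all add: sign_sum_def)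
    show ?thesis
    proof (cases rule: Q.hyperbolic_or_anisotropic[OF S False, case_names hyperbolic anisotropic])
      case h: (hyperbolic x y)
      show ?thesis
      proof (cases rule: Q'.hyperbolic_or_anisotropic[OF S' False', case_names hyperbolic anisotropic])
        case h': (hyperbolic x' y')
        show ?thesis using glue[OF h h'] .
      next
        \<comment> \<open>Mixed types cannot occur: the invariants of \<open>S'\<close> carry over
          to \<open>S\<close>, where they exclude a hyperbolic pair.\<close>
        case a': (anisotropic x' y')
        then show ?thesis
          using aniso'[OF a'] Q.not_hyperbolic[OF S _ _ h(1-4)] h(5) less.prems by simp
      qed
    next
      case a: (anisotropic x y)
      show ?thesis
      proof (cases rule: Q'.hyperbolic_or_anisotropic[OF S' False', case_names hyperbolic anisotropic])
        case h': (hyperbolic x' y')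
        then show ?thesis
          using aniso[OF a] Q'.not_hyperbolic[OF S' _ _ h'(1-4)] h'(5) less.prems by simp
      next
        case a': (anisotropic x' y')
        show ?thesis using glue[OF a(1-5) a'(1-5)] .
      qed
    qed
  qed
qed

section \<open>Invariants of twisted group algebras\<close>

lemma linear_twisted_mult: "linear (twisted_mult f a)"
  using bilinear_twisted_mult[of f] by (simp add: bilinear_def)

text \<open>Multiplication by \<open>e_x\<close> with \<open>x\<close> nonzero moves every basis
  vector off its own line, while \<open>e_0\<close> acts as the identity because
  \<open>f 0 z = 0\<close>. So every diagonal entry is \<open>a $ 0\<close>.\<close>

lemma trace_twisted_mult:
  assumes "bilinear_form f"
  shows "trace (matrix (twisted_mult f a)) = real CARD(bit ^ 'n) * a $ (0 :: bit ^ 'n)"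
proof -
  have "twisted_mult f a (axis z 1) $ z = a $ 0" for z
  proof -
    have "a $ x * axis z 1 $ (x + z) * sign_bit (f x (x + z)) = (if x = 0 then a $ 0 else 0)" for x
      by (auto simp: axis_def bilinear_form_0[OF assms])
    then show ?thesis
      by (simp add: twisted_mult_nth)
  qed
  then show ?thesis
    by (simp add: trace_def matrix_def)
qed

lemma trace_matrix_conjugate:
  fixes \<phi> :: "real ^ 'm \<Rightarrow> real ^ 'm"
  assumes "linear \<phi>" "bij \<phi>" "linear g"
  shows "trace (matrix (\<phi> \<circ> g \<circ> inv \<phi>)) = trace (matrix g)"
proof -
  have inv: "linear (inv \<phi>)"
    using assms(1,2) by (simp add: inj_linear_imp_inv_linear bij_is_inj)
  have "matrix (\<phi> \<circ> g \<circ> inv \<phi>) = matrix \<phi> ** matrix g ** matrix (inv \<phi>)"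
    using assms inv by (simp add: matrix_compose linear_compose)
  then have "trace (matrix (\<phi> \<circ> g \<circ> inv \<phi>)) = trace (matrix (inv \<phi>) ** matrix \<phi> ** matrix g)"
    by (simp add: trace_mul_sym[of _ "matrix (inv \<phi>)"] matrix_mul_assoc)
  also have "matrix (inv \<phi>) ** matrix \<phi> = matrix (inv \<phi> \<circ> \<phi>)"
    using assms(1) inv by (simp add: matrix_compose)
  also have "\<dots> = mat 1"
    using assms(2) by (simp add: bij_is_inj matrix_id_mat_1)
  finally show ?thesis
    by (simp only: matrix_mul_lid)
qed

text \<open>\<open>\<phi>\<close> conjugates left multiplication by \<open>a\<close> into left
  multiplication by \<open>\<phi> a\<close>, so the two traces agree.\<close>

lemma isomorphism_nth_0:
  fixes \<phi> :: "real ^ (bit ^ 'n) \<Rightarrow> real ^ (bit ^ 'n)"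
  assumes f: "bilinear_form f1" "bilinear_form f2"
    and \<phi>: "linear \<phi>" "bij \<phi>" "\<And>a b. \<phi> (twisted_mult f1 a b) = twisted_mult f2 (\<phi> a) (\<phi> b)"
  shows "\<phi> a $ 0 = a $ 0"
proof -
  have "twisted_mult f2 (\<phi> a) = \<phi> \<circ> twisted_mult f1 a \<circ> inv \<phi>"
    using \<phi>(2) by (auto simp: \<phi>(3) bij_is_surj surj_f_inv_f)
  then have "real CARD(bit ^ 'n) * \<phi> a $ 0 = real CARD(bit ^ 'n) * a $ 0"
    using trace_matrix_conjugate[OF \<phi>(1,2) linear_twisted_mult[of f1 a]]
    by (metis trace_twisted_mult f)
  moreover have "real CARD(bit ^ 'n) \<noteq> 0"
    using zero_less_card_finite[where 'a = "bit ^ 'n"] by linarith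
  ultimately show ?thesis
    by (simp only: mult_cancel_left) simp
qed

section \<open>The law of inertia for the coefficient of a square at 0\<close>

lemma twisted_mult_square_nth_0:
  "twisted_mult f a a $ 0 = (\<Sum>x\<in>UNIV. (a $ x)\<^sup>2 * sign_bit (f x x))"
  by (simp add: twisted_mult_nth power2_eq_square)

text \<open>Half of the law of inertia. The first form is positive definite on \<open>P\<close>, the
  second negative definite on \<open>N\<close>, so \<open>\<phi>\<close> maps \<open>P\<close> to a
  subspace meeting \<open>N\<close> only in 0, and the dimensions add up to at most that of the
  whole space.\<close>

lemma isomorphism_card_zeros_le:
  fixes \<phi> :: "real ^ (bit ^ 'n) \<Rightarrow> real ^ (bit ^ 'n)"
  assumes f: "bilinear_form f1" "bilinear_form f2"
    and \<phi>: "linear \<phi>" "bij \<phi>" "\<And>a b. \<phi> (twisted_mult f1 a b) = twisted_mult f2 (\<phi> a) (\<phi> b)"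
  shows "card {x. f1 x x = 0} \<le> card {x. f2 x x = 0}"
proof -
  define P where "P = {a :: real ^ (bit ^ 'n). \<forall>x. x \<notin> {x. f1 x x = 0} \<longrightarrow> a $ x = 0}"
  define N where "N = {b :: real ^ (bit ^ 'n). \<forall>x. x \<notin> - {x. f2 x x = 0} \<longrightarrow> b $ x = 0}"
  have \<phi>': "Vector_Spaces.linear (*s) (*s) \<phi>"
    using \<phi>(1) by (simp add: linear_def scalar_mult_eq_scaleR)
  have "vec.subspace P" "vec.subspace N"
    unfolding P_def N_def by (rule subspace_substandard_cart)+
  have "vec.dim (\<phi> ` P) = vec.dim P"
    by (rule vec.dim_image_eq[OF \<phi>']) (use \<phi>(2) in \<open>auto simp: bij_def inj_on_def\<close>)
  then have dim_P: "vec.dim (\<phi> ` P) = card {x. f1 x x = 0}"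
    by (simp only: P_def dim_substandard_cart)
  have "vec.dim N + card {x. f2 x x = 0} = card (- {x. f2 x x = 0} \<union> {x. f2 x x = 0})"
    by (subst card_Un_disjoint) (simp_all only: N_def dim_substandard_cart, auto)
  then have dim_N: "vec.dim N + card {x. f2 x x = 0} = CARD(bit ^ 'n)"
    by (simp only: Compl_partition2)
  have "\<phi> ` P \<inter> N \<subseteq> {0}"
  proof
    fix b assume b: "b \<in> \<phi> ` P \<inter> N"
    then obtain a where a: "a \<in> P" "b = \<phi> a"
      by auto
    have "(\<Sum>x\<in>UNIV. (a $ x)\<^sup>2 * sign_bit (f1 x x)) = (\<Sum>x\<in>UNIV. (b $ x)\<^sup>2 * sign_bit (f2 x x))"
      using isomorphism_nth_0[OF f \<phi>, of "twisted_mult f1 a a"]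
      by (simp only: \<phi>(3) twisted_mult_square_nth_0 a(2))
    moreover have "(\<Sum>x\<in>UNIV. (a $ x)\<^sup>2 * sign_bit (f1 x x)) = (\<Sum>x\<in>UNIV. (a $ x)\<^sup>2)"
      by (rule sum.cong) (use a(1) in \<open>auto simp: P_def sign_bit_def\<close>)
    moreover have "(\<Sum>x\<in>UNIV. (b $ x)\<^sup>2 * sign_bit (f2 x x)) = (\<Sum>x\<in>UNIV. - (b $ x)\<^sup>2)"
      by (rule sum.cong) (use b in \<open>auto simp: N_def sign_bit_def\<close>)
    \<comment> \<open>The common value of both forms is a sum of squares and also minus a sum of
      squares.\<close>
    ultimately have "(\<Sum>x\<in>UNIV. (a $ x)\<^sup>2) + (\<Sum>x\<in>UNIV. (b $ x)\<^sup>2) = 0"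
      by (simp add: sum_negf)
    then have "(\<Sum>x\<in>UNIV. (b $ x)\<^sup>2) = 0"
      by (simp add: add_nonneg_eq_0_iff sum_nonneg)
    then show "b \<in> {0}"
      by (simp add: sum_nonneg_eq_0_iff vec_eq_iff)
  qed
  then have "vec.dim (\<phi> ` P \<inter> N) = 0"
    using vec.dim_subset[of "\<phi> ` P \<inter> N" "{0}"] by simp
  moreover have "vec.subspace (\<phi> ` P)"
    using \<phi>' \<open>vec.subspace P\<close> by (rule vec.linear_subspace_image)
  ultimately have "vec.dim (\<phi> ` P) + vec.dim N \<le> CARD(bit ^ 'n)"
    using vec.dim_sums_Int[of "\<phi> ` P" N] \<open>vec.subspace N\<close>
      dim_subset_UNIV_cart_gen[of "{x + y |x y. x \<in> \<phi> ` P \<and> y \<in> N}"]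
    by linarith
  then show ?thesis
    using dim_P dim_N by linarith
qed

lemma isomorphism_inv:
  fixes \<phi> :: "real ^ (bit ^ 'n) \<Rightarrow> real ^ (bit ^ 'n)"
  assumes \<phi>: "linear \<phi>" "bij \<phi>" "\<And>a b. \<phi> (twisted_mult f1 a b) = twisted_mult f2 (\<phi> a) (\<phi> b)"
  shows "linear (inv \<phi>)" "bij (inv \<phi>)"
    and "inv \<phi> (twisted_mult f2 a b) = twisted_mult f1 (inv \<phi> a) (inv \<phi> b)"
proof -
  show "linear (inv \<phi>)" "bij (inv \<phi>)"
    using \<phi>(1,2) by (simp_all add: inj_linear_imp_inv_linear bij_is_inj bij_imp_bij_inv)
  have "\<phi> (twisted_mult f1 (inv \<phi> a) (inv \<phi> b)) = twisted_mult f2 a b"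
    using \<phi>(2) by (simp add: \<phi>(3) bij_is_surj surj_f_inv_f)
  then show "inv \<phi> (twisted_mult f2 a b) = twisted_mult f1 (inv \<phi> a) (inv \<phi> b)"
    using \<phi>(2) by (metis bij_inv_eq_iff)
qed

lemma sign_sum_eq_card_zeros:
  fixes q :: "'a::finite \<Rightarrow> bit"
  shows "sign_sum q UNIV = 2 * real (card {x. q x = 0}) - real CARD('a)"
proof -
  have "sign_sum q UNIV = (\<Sum>x\<in>UNIV. 2 * of_bool (q x = 0) - 1)"
    unfolding sign_sum_def by (rule sum.cong) (auto simp: sign_bit_def)
  also have "\<dots> = 2 * real (card {x. q x = 0}) - real CARD('a)"
    by (simp add: sum_subtractf flip: sum_distrib_left)
  finally show ?thesis .
qed

lemma isomorphism_sign_sum_eq: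
  fixes \<phi> :: "real ^ (bit ^ 'n) \<Rightarrow> real ^ (bit ^ 'n)"
  assumes f: "bilinear_form f1" "bilinear_form f2"
    and \<phi>: "linear \<phi>" "bij \<phi>" "\<And>a b. \<phi> (twisted_mult f1 a b) = twisted_mult f2 (\<phi> a) (\<phi> b)"
  shows "sign_sum (\<lambda>x. f1 x x) UNIV = sign_sum (\<lambda>x. f2 x x) UNIV"
  using isomorphism_card_zeros_le[OF f \<phi>] isomorphism_card_zeros_le[OF f(2,1) isomorphism_inv[OF \<phi>]]
  by (simp add: sign_sum_eq_card_zeros)

text \<open>\<open>e_x\<close> and \<open>e_y\<close> commute up to the sign given by
  \<open>f x y + f y x\<close>. The center is described by vanishing coordinates so that its
  dimension can be read off as that of a coordinate subspace.\<close>

lemma center_twisted_mult: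
  "{a :: real ^ (bit ^ 'n). \<forall>c. twisted_mult f a c = twisted_mult f c a} =
    {a. \<forall>x. x \<notin> radical_on (\<lambda>x y. f x y + f y x) UNIV \<longrightarrow> a $ x = 0}"
proof -
  have commute: "f x y = f y x" if "x \<in> radical_on (\<lambda>x y. f x y + f y x) UNIV" for x y
    using that by (simp add: radical_on_def bit_add_eq_0_iff)
  show ?thesis
  proof (intro equalityI subsetI CollectI allI impI)
    fix a x assume "a \<in> {a. \<forall>c. twisted_mult f a c = twisted_mult f c a}"
      and "x \<notin> radical_on (\<lambda>x y. f x y + f y x) UNIV"
    \<comment> \<open>At index \<open>x + y\<close>, multiplying \<open>a\<close> by
      \<open>e_y\<close> on either side leaves only \<open>a $ x\<close>, with signs that differ for
      this \<open>y\<close>.\<close>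
    then obtain y where y: "f x y \<noteq> f y x" and
      eq: "twisted_mult f a (axis y 1) $ (x + y) = twisted_mult f (axis y 1) a $ (x + y)"
      by (auto simp: radical_on_def bit_add_eq_0_iff)
    have "twisted_mult f a (axis y 1) $ (x + y) =
        (\<Sum>u\<in>UNIV. if u = x then a $ x * sign_bit (f x y) else 0)"
      unfolding twisted_mult_nth by (rule sum.cong) (auto simp: axis_def bit_vec_add_eq_0_iff ac_simps)
    moreover have "twisted_mult f (axis y 1) a $ (x + y) =
        (\<Sum>u\<in>UNIV. if u = y then a $ x * sign_bit (f y x) else 0)"
      unfolding twisted_mult_nth by (rule sum.cong) (auto simp: axis_def bit_vec_add_eq_0_iff ac_simps)
    ultimately have "(\<Sum>u\<in>UNIV. if u = x then a $ x * sign_bit (f x y) else 0) =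
        (\<Sum>u\<in>UNIV. if u = y then a $ x * sign_bit (f y x) else 0)"
      by (simp only: eq)
    then have "a $ x * sign_bit (f x y) = a $ x * sign_bit (f y x)"
      by simp
    then show "a $ x = 0"
      using y by (simp add: sign_bit_eq_iff)
  next
    fix a c :: "real ^ (bit ^ 'n)"
    assume a: "a \<in> {a. \<forall>x. x \<notin> radical_on (\<lambda>x y. f x y + f y x) UNIV \<longrightarrow> a $ x = 0}"
    have "twisted_mult f a c $ z = twisted_mult f c a $ z" for z
    proof -
      \<comment> \<open>Termwise, either \<open>x\<close> lies in the radical and the arguments of
        \<open>f\<close> may be swapped, or \<open>a $ x = 0\<close>.\<close>
      have "twisted_mult f a c $ z = (\<Sum>x\<in>UNIV. c $ (x + z) * a $ x * sign_bit (f (x + z) x))"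
        unfolding twisted_mult_nth
      proof (rule sum.cong)
        fix x
        show "a $ x * c $ (x + z) * sign_bit (f x (x + z)) = c $ (x + z) * a $ x * sign_bit (f (x + z) x)"
        proof (cases "x \<in> radical_on (\<lambda>x y. f x y + f y x) UNIV")
          case True
          then show ?thesis
            using commute[of x "x + z"] by simp
        next
          case False
          then have "a $ x = 0"
            using a by blast
          then show ?thesis
            by simp
        qed
      qed simp
      also have "\<dots> = twisted_mult f c a $ z"
        unfolding twisted_mult_nth
        by (rule sum.reindex_bij_witness[of _ "\<lambda>x. x + z" "\<lambda>x. x + z"]) (simp_all add: add.assoc)
      finally show ?thesis .
    qed
    then show "twisted_mult f a c = twisted_mult f c a"
      by (simp add: vec_eq_iff)
  qed
qed

lemma isomorphism_card_radical_eq: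
  fixes \<phi> :: "real ^ (bit ^ 'n) \<Rightarrow> real ^ (bit ^ 'n)"
  assumes \<phi>: "linear \<phi>" "bij \<phi>" "\<And>a b. \<phi> (twisted_mult f1 a b) = twisted_mult f2 (\<phi> a) (\<phi> b)"
  shows "card (radical_on (\<lambda>x y. f1 x y + f1 y x) UNIV) = card (radical_on (\<lambda>x y. f2 x y + f2 y x) UNIV)"
proof -
  let ?C = "\<lambda>f. {a :: real ^ (bit ^ 'n). \<forall>c. twisted_mult f a c = twisted_mult f c a}"
  have dim: "vec.dim (?C f) = card (radical_on (\<lambda>x y. f x y + f y x) UNIV)" for f
    unfolding center_twisted_mult by (rule dim_substandard_cart)
  have \<phi>': "Vector_Spaces.linear (*s) (*s) \<phi>"
    using \<phi>(1) by (simp add: linear_def scalar_mult_eq_scaleR)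
  have "a \<in> ?C f1 \<longleftrightarrow> \<phi> a \<in> ?C f2" for a
  proof -
    have "twisted_mult f1 a c = twisted_mult f1 c a \<longleftrightarrow>
        twisted_mult f2 (\<phi> a) (\<phi> c) = twisted_mult f2 (\<phi> c) (\<phi> a)" for c
      using \<phi>(2) by (simp add: inj_eq bij_is_inj flip: \<phi>(3))
    then show ?thesis
      using \<phi>(2) by (simp add: bij_is_surj surj_def) (metis bij_pointE)
  qed
  then have "\<phi> ` ?C f1 = ?C f2"
    using \<phi>(2) by (auto simp: image_iff) (metis bij_pointE)
  moreover have "vec.dim (\<phi> ` ?C f1) = vec.dim (?C f1)"
    by (rule vec.dim_image_eq[OF \<phi>']) (use \<phi>(2) in \<open>auto simp: bij_def inj_on_def\<close>)
  ultimately show ?thesis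
    by (simp only: dim)
qed

lemma binary_quadratic_form_diagonal:
  assumes "bilinear_form f"
  shows "binary_quadratic_form (\<lambda>x. f x x) (\<lambda>x y. f x y + f y x)"
  by unfold_locales (simp_all add: bilinear_form_add[OF assms] ac_simps)

theorem theorem1:
  fixes f1 f2 :: "(bit, 'n::{finite,linorder}) vec \<Rightarrow> (bit, 'n) vec \<Rightarrow> bit"
    and \<alpha>1 \<alpha>2 :: "(bit, 'n) vec \<Rightarrow> bit"
  assumes "bilinear_form f1" and "bilinear_form f2"
    and "\<And>x. \<alpha>1 x = f1 x x" and "\<And>x. \<alpha>2 x = f2 x x"
  shows "algebra_isomorphic (twisted_mult f1) (twisted_mult f2) \<longleftrightarrow> quadratic_equivalent \<alpha>1 \<alpha>2"
proof
  have \<alpha>: "\<alpha>1 = (\<lambda>x. f1 x x)" "\<alpha>2 = (\<lambda>x. f2 x x)"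
    using assms(3,4) by auto
  {
    assume "algebra_isomorphic (twisted_mult f1) (twisted_mult f2)"
    then obtain \<phi> where \<phi>: "linear \<phi>" "bij \<phi>"
        "\<And>a b. \<phi> (twisted_mult f1 a b) = twisted_mult f2 (\<phi> a) (\<phi> b)"
      unfolding algebra_isomorphic_def by blast
    \<comment> \<open>The order is reversed because equivalence asks for
      \<open>\<alpha>2 x = \<alpha>1 (T x)\<close>, an isometry from the second form to the
      first.\<close>
    have "isometric_on \<alpha>2 UNIV \<alpha>1 UNIV"
      unfolding \<alpha>
      by (rule isometric_on_if_invariants_eq[OF binary_quadratic_form_diagonal[OF assms(2)]
            binary_quadratic_form_diagonal[OF assms(1)]])
        (simp_all add: isomorphism_card_radical_eq[OF \<phi>] isomorphism_sign_sum_eq[OF assms(1,2) \<phi>])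
    then obtain T where T: "bij T" "\<And>x y. T (x + y) = T x + T y" "\<And>x. \<alpha>1 (T x) = \<alpha>2 x"
      unfolding isometric_on_def by auto
    then have "Vector_Spaces.linear (*s) (*s) T"
      by (simp add: linear_bit_vec_iff)
    moreover have "quadratic_form \<alpha>1" "quadratic_form \<alpha>2"
      unfolding \<alpha> using assms(1,2) by (simp_all add: quadratic_form_diagonal)
    ultimately show "quadratic_equivalent \<alpha>1 \<alpha>2"
      unfolding quadratic_equivalent_def using T by metis
  next
    assume "quadratic_equivalent \<alpha>1 \<alpha>2"
    then show "algebra_isomorphic (twisted_mult f1) (twisted_mult f2)"
      unfolding quadratic_equivalent_def \<alpha> using algebra_isomorphic_if_isometry[OF assms(1,2)] by blast
  }
qed

end
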